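(* Let $G$ be a proper interval graph with diameter $D$. Then $$\#TDDP(G)\ \leq\ \min_{0\leq j\leq D}|\Lambda_j|.$$
   Context: All graphs are finite, simple and connected. The diameter of $G$ is the greatest distance between any pair of vertices; a diametral path is a shortest path connecting two vertices whose distance equals the diameter. Two paths are totally disjoint if they have no vertex in common, including their end vertices. $\#TDDP(G)$ denotes the maximum size of a set of pairwise totally disjoint diametral paths in $G$. A proper interval graph is the intersection graph of a family of intervals on the real line in which no interval is totally contained within another; equivalently, the orderings of the intervals by left and by right endpoint coincide. The $n$ vertices are numbered $1,\dots,n$ in the left-to-right order of their intervals, and vertices are compared by these numbers. Each diametral path is oriented from its smaller-numbered endpoint to its larger-numbered endpoint, and its vertices are indexed $0,1,\dots,D$ in this orientation. For $0\le j\le D$, $$\Lambda_j=\{v\in V: v \text{ is the } j\text{-th vertex of some diametral path}\}$$ is the set of vertices that can occupy position $j$. *)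

theory Defs
  imports "Graph_Theory.Graph_Theory"
begin

text \<open>
  A finite simple undirected graph is a digraph satisfying the locale \<^locale>\<open>graph\<close>: finite, loop-free,
  without parallel arcs, and with a symmetric arc relation. A path is the list of its vertices.
\<close>

definition graph_dist :: "('a, 'b) pre_digraph \<Rightarrow> 'a \<Rightarrow> 'a \<Rightarrow> nat" where
  "graph_dist G u v = (LEAST k. \<exists>p. vpath p G \<and> hd p = u \<and> last p = v \<and> vwalk_length p = k)"

definition graph_diameter :: "('a, 'b) pre_digraph \<Rightarrow> nat" where
  "graph_diameter G = Max {graph_dist G u v | u v. u \<in> verts G \<and> v \<in> verts G}"

text \<open>
  A list and its reverse represent the same undirected path, so both directions are admitted here;
  \<open>oriented_diametral_path\<close> selects one of them. Its inequality is non-strict because for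
  diameter 0 the two endpoints are equal.
\<close>

definition diametral_path :: "('a, 'b) pre_digraph \<Rightarrow> 'a list \<Rightarrow> bool" where
  "diametral_path G p \<longleftrightarrow>
     vpath p G \<and> vwalk_length p = graph_dist G (hd p) (last p) \<and>
     graph_dist G (hd p) (last p) = graph_diameter G"

definition oriented_diametral_path :: "('a, 'b) pre_digraph \<Rightarrow> ('a \<Rightarrow> nat) \<Rightarrow> 'a list \<Rightarrow> bool" where
  "oriented_diametral_path G num p \<longleftrightarrow> diametral_path G p \<and> num (hd p) \<le> num (last p)"

definition totally_disjoint :: "'a list \<Rightarrow> 'a list \<Rightarrow> bool" where
  "totally_disjoint p q \<longleftrightarrow> set p \<inter> set q = {}"

text \<open>
  A list and its reverse are never totally disjoint, so no undirected path is counted twice.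
\<close>

definition TDDP_number :: "('a, 'b) pre_digraph \<Rightarrow> nat" where
  "TDDP_number G = Max {card S | S. S \<subseteq> Collect (diametral_path G) \<and> pairwise totally_disjoint S}"

definition Lambda :: "('a, 'b) pre_digraph \<Rightarrow> ('a \<Rightarrow> nat) \<Rightarrow> nat \<Rightarrow> 'a set" where
  "Lambda G num j = {v \<in> verts G. \<exists>p. oriented_diametral_path G num p \<and> j < length p \<and> p ! j = v}"

text \<open>
  The interval of \<open>v\<close> is \<open>{l v..r v}\<close>. Proper containment is excluded, whereas two vertices may have
  the same interval; equivalently, \<open>l u < l v \<longleftrightarrow> r u < r v\<close> for all \<open>u\<close> and \<open>v\<close>.
\<close>

definition proper_interval_rep ::
    "('a, 'b) pre_digraph \<Rightarrow> ('a \<Rightarrow> real) \<Rightarrow> ('a \<Rightarrow> real) \<Rightarrow> bool" where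
  "proper_interval_rep G l r \<longleftrightarrow>
     (\<forall>v \<in> verts G. l v \<le> r v) \<and>
     (\<forall>u \<in> verts G. \<forall>v \<in> verts G. u \<noteq> v \<longrightarrow>
        (u \<rightarrow>\<^bsub>G\<^esub> v \<longleftrightarrow> {l u..r u} \<inter> {l v..r v} \<noteq> {})) \<and>
     (\<forall>u \<in> verts G. \<forall>v \<in> verts G. \<not> {l u..r u} \<subset> {l v..r v})"

text \<open>
  Vertices with the same interval may be numbered in any order.
\<close>

definition left_to_right_numbering ::
    "('a, 'b) pre_digraph \<Rightarrow> ('a \<Rightarrow> real) \<Rightarrow> ('a \<Rightarrow> nat) \<Rightarrow> bool" where
  "left_to_right_numbering G l num \<longleftrightarrow>
     bij_betw num (verts G) {1..card (verts G)} \<and>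
     (\<forall>u \<in> verts G. \<forall>v \<in> verts G. l u < l v \<longrightarrow> num u < num v)"

end

theory Submission
  imports Defs
begin

text \<open>
  Assign to each path of a totally disjoint family the \<open>j\<close>-th vertex of its orientation. That vertex
  lies on the path, so distinct paths receive distinct vertices of the \<open>j\<close>-th set, and the family is
  no larger than that set.
\<close>

context sym_digraph
begin

lemma vpath_rev:
  assumes "vpath p G"
  shows "vpath (rev p) G"
  using assms vwalk_rev_ex[OF sym_arcs] by (simp add: vpath_def)

text \<open>Reversal preserves length, so both \<open>LEAST\<close> operators see the same
  predicate; this holds even if no path joins the two vertices.\<close>

lemma graph_dist_sym: "graph_dist G u v = graph_dist G v u"
proof -
  \<comment> \<open>\<open>u\<close> and \<open>v\<close> are generalised afresh, so this one
    implication serves both directions of the equivalence.\<close>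
  have "\<exists>p. vpath p G \<and> hd p = v \<and> last p = u \<and> vwalk_length p = k"
    if "\<exists>p. vpath p G \<and> hd p = u \<and> last p = v \<and> vwalk_length p = k" for u v k
  proof -
    from that obtain p where "vpath p G" "hd p = u" "last p = v" "vwalk_length p = k"
      by blast
    then show ?thesis
      by (intro exI[of _ "rev p"]) (simp add: hd_rev last_rev vpath_rev)
  qed
  then show ?thesis
    unfolding graph_dist_def by (intro arg_cong[where f = Least] ext iffI)
qed

text \<open>This allows a member of a family to be turned towards its larger-numbered end while
  staying diametral.\<close>

lemma diametral_path_rev:
  assumes "diametral_path G p"
  shows "diametral_path G (rev p)"
proof (cases "p = []")
  case False
  then have "hd (rev p) = last p" "last (rev p) = hd p"
    by (simp_all add: hd_rev last_rev)
  then show ?thesis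
    using assms vpath_rev[of p] graph_dist_sym[of "last p" "hd p"]
    by (simp only: diametral_path_def vwalk_length_simp length_rev)
qed (use assms in simp)

lemma card_disjoint_diametral_paths_le_Lambda:
  assumes S: "S \<subseteq> Collect (diametral_path G)" and disj: "pairwise totally_disjoint S"
    and j: "j \<le> graph_diameter G" and fin: "finite (verts G)"
  shows "card S \<le> card (Lambda G num j)"
proof -
  define orient where "orient p = (if num (hd p) \<le> num (last p) then p else rev p)" for p
  define f where "f p = orient p ! j" for p
  have f: "f p \<in> set p" "f p \<in> Lambda G num j" if "p \<in> S" for p
  proof -
    have p: "diametral_path G p"
      using that S by blast
    then have vp: "p \<noteq> []" "set p \<subseteq> verts G"
      by (auto simp: diametral_path_def vpath_def vwalk_def)
    \<comment> \<open>\<open>vwalk_length\<close> counts arcs, so a diametral path has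
      \<open>graph_diameter G + 1\<close> entries and even \<open>j = graph_diameter G\<close> is a
      valid index.\<close>
    have len: "j < length (orient p)"
      using p j vp by (cases p) (auto simp: orient_def diametral_path_def)
    have "set (orient p) = set p"
      by (simp add: orient_def)
    then show mem: "f p \<in> set p"
      using nth_mem[OF len] by (simp add: f_def)
    have "oriented_diametral_path G num (orient p)"
      using p diametral_path_rev vp
      by (auto simp: oriented_diametral_path_def orient_def hd_rev last_rev)
    then show "f p \<in> Lambda G num j"
      using mem vp len by (auto simp: Lambda_def f_def)
  qed
  have "inj_on f S"
  proof (rule inj_onI)
    fix p q assume "p \<in> S" "q \<in> S" "f p = f q"
    then have "\<not> totally_disjoint p q"
      using f(1)[of p] f(1)[of q] by (auto simp: totally_disjoint_def)
    then show "p = q"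
      using disj \<open>p \<in> S\<close> \<open>q \<in> S\<close> by (auto simp: pairwise_def)
  qed
  moreover have "finite (Lambda G num j)"
    using fin by (simp add: Lambda_def)
  \<comment> \<open>An injection into a finite set bounds \<open>card S\<close> without a separate
    proof that \<open>S\<close> is finite.\<close>
  ultimately show ?thesis
    using f(2) by (intro card_inj_on_le) auto
qed

end

theorem theorem9:
  fixes G :: "('a, 'b) pre_digraph"
    and l r :: "'a \<Rightarrow> real"
    and num :: "'a \<Rightarrow> nat"
  assumes "graph G"
    and "connected G"
    and "proper_interval_rep G l r"
    and "left_to_right_numbering G l num"
  shows "TDDP_number G \<le> Min {card (Lambda G num j) | j. j \<le> graph_diameter G}"
proof -
  interpret graph G by fact
  let ?C = "{card S | S. S \<subseteq> Collect (diametral_path G) \<and> pairwise totally_disjoint S}"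
  let ?L = "{card (Lambda G num j) | j. j \<le> graph_diameter G}"
  have le: "c \<le> card (Lambda G num j)" if "c \<in> ?C" "j \<le> graph_diameter G" for c j
    using that card_disjoint_diametral_paths_le_Lambda by auto
  \<comment> \<open>\<open>Max\<close> is sure to be attained only on a finite nonempty set. Index 0
    never exceeds the diameter, so the bound at 0 gives finiteness.\<close>
  have "finite ?C"
    using le[of _ 0] by (auto intro: finite_subset[of _ "{..card (Lambda G num 0)}"])
  \<comment> \<open>The empty family shows that \<open>?C\<close> is nonempty.\<close>
  moreover have "card {} \<in> ?C"
    by (intro CollectI exI[of _ "{}"]) (simp add: pairwise_def)
  ultimately have "TDDP_number G \<in> ?C"
    unfolding TDDP_number_def by (intro Max_in) auto
  \<comment> \<open>The maximum is the size of an actual family, so \<open>le\<close> applies to it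
    at every index.\<close>
  then have "TDDP_number G \<le> c" if "c \<in> ?L" for c
    using le[of "TDDP_number G"] that by blast
  moreover have "finite ?L" "?L \<noteq> {}"
    by auto
  ultimately show ?thesis
    by (intro Min.boundedI)
qed

end
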